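(* Let $G=(V,E)$ be a finite graph, let $k\ge 1$, and let $C:\mathrm{Prob}(V)\times \mathrm{Prob}(V)\to\mathbb{R}$ be any metric on $\mathrm{Prob}(V)$. Then the lifted distance $A:\mathrm{Prob}(V)^{k*}\times \mathrm{Prob}(V)^{k*}\to\mathbb{R}$ defined by $$A(X,Y)=\min_{S\in \mathrm{DS}_k}\ \sum_{i,j=1}^k S_{ij}\,C(x_i,y_j),\qquad X=(x_1,\dots,x_k),\ Y=(y_1,\dots,y_k),$$ is a metric on $\mathrm{Prob}(V)^{k*}$.
   Context: $\mathrm{Prob}(V)=\{x\in\mathbb{R}^{|V|} : x(v)\ge 0\ \forall v\in V,\ \sum_{v\in V}x(v)=1\}$ is the set of probability distributions on the finite set $V$. $\mathrm{Prob}(V)^{k*}$ is the set of $k$-tuples of elements of $\mathrm{Prob}(V)$ up to reordering (the quotient of $\mathrm{Prob}(V)^k$ by permutations of the indices). $\mathrm{DS}_k=\{S\in\mathbb{R}^{k\times k} : S\mathbf{1}=\mathbf{1},\ S^\top\mathbf{1}=\mathbf{1},\ S\ge 0\}$ is the Birkhoff polytope of doubly stochastic $k\times k$ matrices. The value $A(X,Y)$ does not depend on the chosen orderings of the tuples. *)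

theory Defs
  imports "HOL-Analysis.Analysis" "Graph_Theory.Digraph"
begin

text \<open>\<open>\<real>\<^sup>V\<close> is the set of functions that are extensional on \<open>V\<close>, so
  that equality of distributions is equality of their values on \<open>V\<close>.\<close>

definition Prob :: "'v set \<Rightarrow> ('v \<Rightarrow> real) set" where
  "Prob V = {x \<in> V \<rightarrow>\<^sub>E UNIV. (\<forall>v\<in>V. 0 \<le> x v) \<and> (\<Sum>v\<in>V. x v) = 1}"

text \<open>The number \<open>k \<ge> 1\<close> is the cardinality of a finite index type \<open>'k\<close>: a
  \<open>k\<close>-tuple is a function on \<open>'k\<close>, and a permutation of the indices is a bijection
  of \<open>'k\<close>.\<close>

definition Prob_tuples :: "'v set \<Rightarrow> ('k::finite \<Rightarrow> 'v \<Rightarrow> real) set" where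
  "Prob_tuples V = {x. \<forall>i. x i \<in> Prob V}"

definition reordering :: "'v set \<Rightarrow> (('k::finite \<Rightarrow> 'v \<Rightarrow> real) \<times> ('k \<Rightarrow> 'v \<Rightarrow> real)) set" where
  "reordering V = {(x, y) \<in> Prob_tuples V \<times> Prob_tuples V. \<exists>\<pi>. bij \<pi> \<and> y = x \<circ> \<pi>}"

definition Prob_unordered_tuples :: "'v set \<Rightarrow> ('k::finite \<Rightarrow> 'v \<Rightarrow> real) set set" where
  "Prob_unordered_tuples V = Prob_tuples V // reordering V"

text \<open>Here \<open>1\<close> is the all-ones vector of \<^typ>\<open>real ^ 'k\<close>.\<close>

definition doubly_stochastic :: "(real ^ 'k::finite ^ 'k) set" where
  "doubly_stochastic =
     {S. S *v 1 = 1 \<and> Finite_Cartesian_Product.transpose S *v 1 = 1 \<and> (\<forall>i j. 0 \<le> S $ i $ j)}"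

text \<open>On the reals \<open>LEAST\<close> denotes the minimum of a set only if it is attained, and is
  unspecified otherwise.\<close>

definition tuple_dist ::
  "(('v \<Rightarrow> real) \<Rightarrow> ('v \<Rightarrow> real) \<Rightarrow> real) \<Rightarrow>
     ('k::finite \<Rightarrow> 'v \<Rightarrow> real) \<Rightarrow> ('k \<Rightarrow> 'v \<Rightarrow> real) \<Rightarrow> real" where
  "tuple_dist C x y =
     (LEAST c. c \<in> (\<lambda>S. \<Sum>i\<in>UNIV. \<Sum>j\<in>UNIV. S $ i $ j * C (x i) (y j)) ` doubly_stochastic)"

text \<open>The common value of \<^const>\<open>tuple_dist\<close> over all orderings of the two arguments
  (\<^const>\<open>the_elem\<close> is unspecified if there is no common value). The value \<open>0\<close>
  outside the carrier is a convention: \<^locale>\<open>Metric_space\<close> demands nonnegativity and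
  symmetry on the whole type.\<close>

definition lifted_dist ::
  "'v set \<Rightarrow> (('v \<Rightarrow> real) \<Rightarrow> ('v \<Rightarrow> real) \<Rightarrow> real) \<Rightarrow>
     ('k::finite \<Rightarrow> 'v \<Rightarrow> real) set \<Rightarrow> ('k \<Rightarrow> 'v \<Rightarrow> real) set \<Rightarrow> real" where
  "lifted_dist V C X Y =
     (if X \<in> Prob_unordered_tuples V \<and> Y \<in> Prob_unordered_tuples V
      then the_elem (\<Union>x\<in>X. \<Union>y\<in>Y. {tuple_dist C x y})
      else 0)"

end

theory Submission
  imports Defs
begin

text \<open>On ordered tuples the lifted distance is a pseudometric: a product of doubly stochastic
  matrices is a coupling that witnesses the triangle inequality. Its zero relation is reordering: a
  permutation matrix has cost \<open>0\<close> between a tuple and its reordering, and conversely an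
  optimal \<open>S\<close> of cost \<open>0\<close> is supported where \<open>x i = y j\<close>, so that
  summing the entries of \<open>S\<close> over a fibre by rows and by columns shows that \<open>x\<close>
  and \<open>y\<close> take every value equally often. The quotient of a pseudometric by its zero
  relation is a metric.\<close>

section \<open>Metric quotient of a pseudometric\<close>

text \<open>The triangle inequality makes \<open>d\<close> constant on each pair of classes, so
  \<open>the_elem\<close> picks a genuine common value. The distance is spelled out in this form to
  coincide with the unfolded \<open>lifted_dist\<close>.\<close>

lemma Metric_space_quotient:
  fixes d :: "'a \<Rightarrow> 'a \<Rightarrow> real"
  assumes r: "r = {(x, y) \<in> P \<times> P. d x y = 0}"
    and refl: "\<And>x. x \<in> P \<Longrightarrow> d x x = 0"
    and nonneg: "\<And>x y. x \<in> P \<Longrightarrow> y \<in> P \<Longrightarrow> 0 \<le> d x y"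
    and comm: "\<And>x y. x \<in> P \<Longrightarrow> y \<in> P \<Longrightarrow> d x y = d y x"
    and tri: "\<And>x y z. x \<in> P \<Longrightarrow> y \<in> P \<Longrightarrow> z \<in> P \<Longrightarrow> d x z \<le> d x y + d y z"
  shows "Metric_space (P // r)
    (\<lambda>X Y. if X \<in> P // r \<and> Y \<in> P // r then the_elem (\<Union>x\<in>X. \<Union>y\<in>Y. {d x y}) else 0)"
    (is "Metric_space _ ?D")
proof -
  have cls: "r `` {x} = {x' \<in> P. d x x' = 0}" if "x \<in> P" for x
    using that by (auto simp: r)
  have D: "?D (r `` {x}) (r `` {y}) = d x y" if "x \<in> P" "y \<in> P" for x y
  proof -
    have same: "d x' y' = d x y" if "x' \<in> r `` {x}" "y' \<in> r `` {y}" for x' y'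
    proof -
      have *: "x' \<in> P" "y' \<in> P" "d x x' = 0" "d y y' = 0"
        using that \<open>x \<in> P\<close> \<open>y \<in> P\<close> by (auto simp: cls)
      \<comment> \<open>Two triangle inequalities in each direction sandwich the values, since the
        legs \<open>d x x'\<close> and \<open>d y y'\<close> vanish.\<close>
      show ?thesis
        using tri[of x' x y'] tri[of x y y'] tri[of x x' y] tri[of x' y' y]
          comm[of x x'] comm[of y y'] * \<open>x \<in> P\<close> \<open>y \<in> P\<close> by simp
    qed
    have "x \<in> r `` {x}" "y \<in> r `` {y}"
      using that refl by (auto simp: cls)
    then have "(\<Union>x\<in>r `` {x}. \<Union>y\<in>r `` {y}. {d x y}) = {d x y}"
      using same by blast
    then show ?thesis
      using that by (simp add: quotientI)
  qed
  have ex: "\<exists>x\<in>P. X = r `` {x}" if "X \<in> P // r" for X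
    using that by (auto elim: quotientE)
  show ?thesis
  proof
    fix X Y
    show "0 \<le> ?D X Y"
    proof (cases "X \<in> P // r \<and> Y \<in> P // r")
      case True
      then obtain x y where "x \<in> P" "y \<in> P" "X = r `` {x}" "Y = r `` {y}"
        using ex by meson
      then show ?thesis
        by (simp only: D nonneg)
    qed auto
    show "?D X Y = ?D Y X"
    proof (cases "X \<in> P // r \<and> Y \<in> P // r")
      case True
      then obtain x y where "x \<in> P" "y \<in> P" "X = r `` {x}" "Y = r `` {y}"
        using ex by meson
      then show ?thesis
        by (simp only: D comm[of x y])
    qed auto
  next
    fix X Y
    assume "X \<in> P // r" "Y \<in> P // r"
    then obtain x y where xy: "x \<in> P" "y \<in> P" "X = r `` {x}" "Y = r `` {y}"
      using ex by meson
    have "X = Y" if "d x y = 0"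
    proof -
      \<comment> \<open>Points at distance 0 have the same distance to every third point, hence the
        same zero set, which is the class.\<close>
      have "d x z = d y z" if "z \<in> P" for z
        using tri[of x y z] tri[of y x z] comm[of x y] \<open>d x y = 0\<close> xy that by simp
      then show ?thesis
        using xy by (auto simp: cls)
    qed
    moreover have "d x y = 0" if "X = Y"
      using that xy refl by (auto simp: cls)
    ultimately show "?D X Y = 0 \<longleftrightarrow> X = Y"
      unfolding xy D[OF xy(1,2)] by blast
  next
    fix X Y Z
    assume "X \<in> P // r" "Y \<in> P // r" "Z \<in> P // r"
    then obtain x y z where "x \<in> P" "y \<in> P" "z \<in> P" "X = r `` {x}" "Y = r `` {y}" "Z = r `` {z}"
      using ex by meson
    then show "?D X Z \<le> ?D X Y + ?D Y Z"
      by (simp only: D tri)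
  qed
qed

section \<open>The Birkhoff polytope: permutation matrices, products, compactness\<close>

lemma doubly_stochastic_iff:
  "S \<in> doubly_stochastic \<longleftrightarrow>
    (\<forall>i. (\<Sum>j\<in>UNIV. S $ i $ j) = 1) \<and> (\<forall>j. (\<Sum>i\<in>UNIV. S $ i $ j) = 1) \<and> (\<forall>i j. 0 \<le> S $ i $ j)"
  by (simp add: doubly_stochastic_def matrix_vector_mult_def Finite_Cartesian_Product.transpose_def
      vec_eq_iff)

lemma doubly_stochastic_permutation:
  fixes \<pi> :: "'k::finite \<Rightarrow> 'k"
  assumes "bij \<pi>"
  shows "(\<chi> i j. if i = \<pi> j then 1 else 0) \<in> doubly_stochastic"
proof -
  \<comment> \<open>Column \<open>j\<close> has its one in row \<open>\<pi> j\<close>; for the row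
    sums the condition is solved for \<open>j\<close>.\<close>
  have "(i = \<pi> j) = (inv \<pi> i = j)" for i j
    using assms by (metis bij_inv_eq_iff)
  then have "(\<Sum>j\<in>UNIV. if i = \<pi> j then 1 else 0) = (1 :: real)" for i
    by simp
  then show ?thesis
    by (simp add: doubly_stochastic_iff)
qed

lemma doubly_stochastic_transpose:
  "S \<in> doubly_stochastic \<Longrightarrow> Finite_Cartesian_Product.transpose S \<in> doubly_stochastic"
  by (simp add: doubly_stochastic_iff Finite_Cartesian_Product.transpose_def)

text \<open>Both factors fix the all-ones vector, hence so does their product; the transposed
  product is the same argument in reverse order.\<close>

lemma doubly_stochastic_mult:
  assumes "S \<in> doubly_stochastic" "T \<in> doubly_stochastic"
  shows "S ** T \<in> doubly_stochastic"
proof -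
  have "S ** T *v 1 = 1"
    using assms by (simp only: doubly_stochastic_def mem_Collect_eq flip: matrix_vector_mul_assoc)
  moreover have "Finite_Cartesian_Product.transpose (S ** T) *v 1 = 1"
    using assms by (simp only: doubly_stochastic_def mem_Collect_eq matrix_transpose_mul
        flip: matrix_vector_mul_assoc)
  moreover have "0 \<le> (S ** T) $ i $ j" for i j
    using assms by (auto simp: doubly_stochastic_def matrix_matrix_mult_def intro!: sum_nonneg)
  ultimately show ?thesis
    by (simp only: doubly_stochastic_def mem_Collect_eq simp_thms)
qed

lemma compact_doubly_stochastic:
  "compact (doubly_stochastic :: (real ^ 'k::finite ^ 'k) set)"
proof -
  have "S $ i $ j \<le> 1" if "S \<in> doubly_stochastic" for S :: "real ^ 'k ^ 'k" and i j
  proof -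
    have "S $ i $ j \<le> (\<Sum>j\<in>UNIV. S $ i $ j)"
      using that by (intro member_le_sum) (auto simp: doubly_stochastic_iff)
    then show ?thesis
      using that by (simp add: doubly_stochastic_iff)
  qed
  \<comment> \<open>The interval is taken in the entrywise order, so it is a compact box of
    matrices.\<close>
  then have sub: "(doubly_stochastic :: (real ^ 'k ^ 'k) set) \<subseteq> {0..1}"
    by (auto simp: less_eq_vec_def doubly_stochastic_iff)
  have "closed (doubly_stochastic :: (real ^ 'k ^ 'k) set)"
    unfolding doubly_stochastic_def matrix_vector_mult_def Finite_Cartesian_Product.transpose_def
    by (intro closed_Collect_conj closed_Collect_all closed_Collect_eq closed_Collect_le
        continuous_intros)
  then have "compact ({0..1} \<inter> (doubly_stochastic :: (real ^ 'k ^ 'k) set))"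
    by (intro compact_Int_closed compact_interval)
  then show ?thesis
    using sub by (simp add: Int_absorb1)
qed

section \<open>Attainment of the minimal coupling cost\<close>

text \<open>The objective minimised in \<open>tuple_dist\<close>. For doubly stochastic
  \<open>S\<close> it is \<open>k\<close> times the transport cost of the coupling
  \<open>S / k\<close> of two uniform measures on \<open>k\<close> indices.\<close>

definition coupling_cost ::
  "('a \<Rightarrow> 'b \<Rightarrow> real) \<Rightarrow> ('k::finite \<Rightarrow> 'a) \<Rightarrow> ('k \<Rightarrow> 'b) \<Rightarrow> real ^ 'k ^ 'k \<Rightarrow> real" where
  "coupling_cost C x y S = (\<Sum>i\<in>UNIV. \<Sum>j\<in>UNIV. S $ i $ j * C (x i) (y j))"

text \<open>The cost is linear, hence continuous, in \<open>S\<close>, and the polytope is compact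
  and nonempty (it contains the identity matrix). So the minimum exists and \<open>LEAST\<close>
  denotes it.\<close>

lemma tuple_dist_attained:
  "\<exists>S\<in>doubly_stochastic. tuple_dist C x y = coupling_cost C x y S"
  and tuple_dist_le: "S \<in> doubly_stochastic \<Longrightarrow> tuple_dist C x y \<le> coupling_cost C x y S"
proof -
  have "continuous_on doubly_stochastic (coupling_cost C x y)"
    unfolding coupling_cost_def by (intro continuous_intros)
  moreover have "doubly_stochastic \<noteq> {}"
    using doubly_stochastic_permutation[OF bij_id] by blast
  ultimately obtain S where S: "S \<in> doubly_stochastic"
    "\<And>T. T \<in> doubly_stochastic \<Longrightarrow> coupling_cost C x y S \<le> coupling_cost C x y T"
    using continuous_attains_inf[OF compact_doubly_stochastic] by metis
  have "tuple_dist C x y = coupling_cost C x y S"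
    unfolding tuple_dist_def
    by (rule Least_equality) (use S in \<open>auto simp: coupling_cost_def\<close>)
  then show "\<exists>S\<in>doubly_stochastic. tuple_dist C x y = coupling_cost C x y S"
    and "S \<in> doubly_stochastic \<Longrightarrow> tuple_dist C x y \<le> coupling_cost C x y S" for S
    using S by auto
qed

section \<open>Reordering from equal multiplicities\<close>

text \<open>Fibres over the same value are in bijection, and these bijections glue because the
  fibres partition the index type.\<close>

lemma bij_if_card_fibres_eq:
  fixes x y :: "'k::finite \<Rightarrow> 'a"
  assumes "\<And>a. card {i. x i = a} = card {j. y j = a}"
  shows "\<exists>\<pi>. bij \<pi> \<and> y = x \<circ> \<pi>"
proof -
  have "\<exists>f. bij_betw f {j. y j = a} {i. x i = a}" for a
    using assms by (metis bij_betw_iff_card finite)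
  then obtain f where f: "bij_betw (f a) {j. y j = a} {i. x i = a}" for a
    by metis
  \<comment> \<open>Each index is moved by the bijection belonging to its own fibre.\<close>
  define \<pi> where "\<pi> j = f (y j) j" for j
  have x\<pi>: "x (\<pi> j) = y j" for j
    using bij_betwE[OF f[of "y j"]] by (simp add: \<pi>_def)
  have "inj \<pi>"
  proof (rule injI)
    fix j j'
    assume eq: "\<pi> j = \<pi> j'"
    then have "y j = y j'"
      by (metis x\<pi>)
    then show "j = j'"
      using eq bij_betw_imp_inj_on[OF f[of "y j"]] by (auto simp: \<pi>_def dest: inj_onD)
  qed
  then have "bij \<pi>"
    by (simp add: bij_def finite_UNIV_inj_surj)
  then show ?thesis
    using x\<pi> by fastforce
qed

section \<open>Coupling costs over a metric\<close>

context Metric_space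
begin

lemma coupling_cost_nonneg:
  "S \<in> doubly_stochastic \<Longrightarrow> 0 \<le> coupling_cost d x y S"
  by (auto simp: coupling_cost_def doubly_stochastic_iff intro!: sum_nonneg)

lemma coupling_cost_transpose:
  "coupling_cost d y x (Finite_Cartesian_Product.transpose S) = coupling_cost d x y S"
  unfolding coupling_cost_def Finite_Cartesian_Product.transpose_def
  by (subst sum.swap) (simp add: commute)

text \<open>The gluing argument of optimal transport: \<open>S $ i $ j * T $ j $ l\<close> is the
  mass sent from \<open>i\<close> to \<open>l\<close> through \<open>j\<close>, and each such route
  obeys the triangle inequality.\<close>

lemma coupling_cost_mult_le:
  fixes x y z :: "'k::finite \<Rightarrow> 'a"
  assumes x: "\<And>i. x i \<in> M" and y: "\<And>i. y i \<in> M" and z: "\<And>i. z i \<in> M"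
    and S: "S \<in> doubly_stochastic" and T: "T \<in> doubly_stochastic"
  shows "coupling_cost d x z (S ** T) \<le> coupling_cost d x y S + coupling_cost d y z T"
proof -
  have "coupling_cost d x z (S ** T) = (\<Sum>i\<in>UNIV. \<Sum>l\<in>UNIV. \<Sum>j\<in>UNIV. S $ i $ j * T $ j $ l * d (x i) (z l))"
    by (simp add: coupling_cost_def matrix_matrix_mult_def sum_distrib_right)
  also have "\<dots> \<le> (\<Sum>i\<in>UNIV. \<Sum>l\<in>UNIV. \<Sum>j\<in>UNIV. S $ i $ j * T $ j $ l * (d (x i) (y j) + d (y j) (z l)))"
    using S T x y z
    by (intro sum_mono mult_left_mono triangle mult_nonneg_nonneg) (auto simp: doubly_stochastic_iff)
  \<comment> \<open>The bracketing isolates the factor to be summed out: \<open>T $ j $ l\<close>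
    over \<open>l\<close> in the first sum, \<open>S $ i $ j\<close> over \<open>i\<close> in the
    second. Row sums of \<open>T\<close> and column sums of \<open>S\<close> are 1.\<close>
  also have "\<dots> = (\<Sum>i\<in>UNIV. \<Sum>l\<in>UNIV. \<Sum>j\<in>UNIV. S $ i $ j * d (x i) (y j) * T $ j $ l)
      + (\<Sum>i\<in>UNIV. \<Sum>l\<in>UNIV. \<Sum>j\<in>UNIV. S $ i $ j * (T $ j $ l * d (y j) (z l)))"
    by (simp add: sum.distrib algebra_simps)
  also have "(\<Sum>i\<in>UNIV. \<Sum>l\<in>UNIV. \<Sum>j\<in>UNIV. S $ i $ j * d (x i) (y j) * T $ j $ l)
      = (\<Sum>i\<in>UNIV. \<Sum>j\<in>UNIV. S $ i $ j * d (x i) (y j) * (\<Sum>l\<in>UNIV. T $ j $ l))"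
    unfolding sum_distrib_left by (rule sum.cong[OF refl sum.swap])
  also have "\<dots> = coupling_cost d x y S"
    using T by (simp add: coupling_cost_def doubly_stochastic_iff)
  also have "(\<Sum>i\<in>UNIV. \<Sum>l\<in>UNIV. \<Sum>j\<in>UNIV. S $ i $ j * (T $ j $ l * d (y j) (z l)))
      = (\<Sum>l\<in>UNIV. \<Sum>j\<in>UNIV. (\<Sum>i\<in>UNIV. S $ i $ j) * (T $ j $ l * d (y j) (z l)))"
    unfolding sum_distrib_right
    by (rule trans[OF sum.swap sum.cong[OF refl sum.swap]])
  also have "\<dots> = coupling_cost d y z T"
    using S by (simp add: coupling_cost_def doubly_stochastic_iff) (rule sum.swap)
  finally show ?thesis .
qed

text \<open>An entry is nonzero only if \<open>i = \<pi> j\<close>, and there the two points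
  coincide.\<close>

lemma coupling_cost_permutation:
  assumes "\<And>i. x i \<in> M"
  shows "coupling_cost d x (x \<circ> \<pi>) (\<chi> i j. if i = \<pi> j then 1 else 0) = 0"
  unfolding coupling_cost_def by (intro sum.neutral ballI) (use assms in auto)

lemma reordering_if_coupling_cost_zero:
  fixes x y :: "'k::finite \<Rightarrow> 'a"
  assumes x: "\<And>i. x i \<in> M" and y: "\<And>i. y i \<in> M"
    and S: "S \<in> doubly_stochastic" and cost0: "coupling_cost d x y S = 0"
  shows "\<exists>\<pi>. bij \<pi> \<and> y = x \<circ> \<pi>"
proof (rule bij_if_card_fibres_eq)
  fix a
  have S_nonneg: "0 \<le> S $ i $ j" for i j
    using S by (simp add: doubly_stochastic_iff)
  \<comment> \<open>A vanishing sum of nonnegative terms vanishes termwise, so mass moves only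
    between equal points.\<close>
  have prod0: "S $ i $ j * d (x i) (y j) = 0" for i j
    using cost0 S_nonneg by (simp add: coupling_cost_def sum_nonneg_eq_0_iff sum_nonneg)
  then have off: "S $ i $ j = 0" if "x i \<noteq> y j" for i j
    using prod0[of i j] that x y by simp
  \<comment> \<open>The cardinality is the total mass of the rows in the fibre. By
    \<open>off\<close> this mass lies in the block of both fibres, which is likewise the total mass
    of the columns in the fibre of \<open>y\<close>.\<close>
  have "real (card {i. x i = a}) = (\<Sum>i | x i = a. \<Sum>j\<in>UNIV. S $ i $ j)"
    using S by (simp add: doubly_stochastic_iff)
  also have "\<dots> = (\<Sum>i | x i = a. \<Sum>j | y j = a. S $ i $ j)"
    by (rule sum.cong[OF refl], rule sum.mono_neutral_right) (auto intro: off)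
  also have "\<dots> = (\<Sum>j | y j = a. \<Sum>i | x i = a. S $ i $ j)"
    by (rule sum.swap)
  also have "\<dots> = (\<Sum>j | y j = a. \<Sum>i\<in>UNIV. S $ i $ j)"
    by (rule sum.cong[OF refl], rule sum.mono_neutral_left) (auto intro: off)
  also have "\<dots> = real (card {j. y j = a})"
    using S by (simp add: doubly_stochastic_iff)
  finally show "card {i. x i = a} = card {j. y j = a}"
    by simp
qed

end

section \<open>The lifted distance on unordered tuples\<close>

theorem proposition5p5:
  fixes G :: "('v, 'e) pre_digraph"
    and C :: "('v \<Rightarrow> real) \<Rightarrow> ('v \<Rightarrow> real) \<Rightarrow> real"
  assumes "pseudo_graph G"
    and "Metric_space (Prob (verts G)) C"
  shows "Metric_space
           (Prob_unordered_tuples (verts G) :: ('k::finite \<Rightarrow> 'v \<Rightarrow> real) set set)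
           (lifted_dist (verts G) C)"
proof -
  interpret Metric_space "Prob (verts G)" C by fact
  let ?P = "Prob_tuples (verts G) :: ('k \<Rightarrow> 'v \<Rightarrow> real) set"
  have P: "x i \<in> Prob (verts G)" if "x \<in> ?P" for x i
    using that by (simp add: Prob_tuples_def)
  have nonneg: "0 \<le> tuple_dist C x y" for x y :: "'k \<Rightarrow> 'v \<Rightarrow> real"
    using tuple_dist_attained coupling_cost_nonneg by metis
  \<comment> \<open>Transposing an optimal matrix gives one inequality; exchanging \<open>x\<close>
    and \<open>y\<close> gives the other.\<close>
  have "tuple_dist C y x \<le> tuple_dist C x y" for x y :: "'k \<Rightarrow> 'v \<Rightarrow> real"
  proof -
    obtain S where S: "S \<in> doubly_stochastic" "tuple_dist C x y = coupling_cost C x y S"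
      using tuple_dist_attained by blast
    show ?thesis
      using tuple_dist_le[OF doubly_stochastic_transpose[OF S(1)], of C y x] S(2)
      by (simp add: coupling_cost_transpose)
  qed
  then have comm: "tuple_dist C x y = tuple_dist C y x" for x y :: "'k \<Rightarrow> 'v \<Rightarrow> real"
    by (simp add: antisym)
  have tri: "tuple_dist C x z \<le> tuple_dist C x y + tuple_dist C y z"
    if "x \<in> ?P" "y \<in> ?P" "z \<in> ?P" for x y z
  proof -
    obtain S T where ST: "S \<in> doubly_stochastic" "tuple_dist C x y = coupling_cost C x y S"
      "T \<in> doubly_stochastic" "tuple_dist C y z = coupling_cost C y z T"
      using tuple_dist_attained by meson
    have "tuple_dist C x z \<le> coupling_cost C x z (S ** T)"
      by (intro tuple_dist_le doubly_stochastic_mult ST)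
    also have "\<dots> \<le> coupling_cost C x y S + coupling_cost C y z T"
      by (intro coupling_cost_mult_le P that ST)
    finally show ?thesis
      by (simp only: ST)
  qed
  \<comment> \<open>The permutation matrix bounds the minimum above by 0, and \<open>nonneg\<close>
    bounds it below.\<close>
  have perm: "tuple_dist C x (x \<circ> \<pi>) = 0" if "x \<in> ?P" "bij \<pi>" for x \<pi>
    using tuple_dist_le[OF doubly_stochastic_permutation[OF \<open>bij \<pi>\<close>], of C x "x \<circ> \<pi>"]
      coupling_cost_permutation[of x \<pi>, OF P[OF \<open>x \<in> ?P\<close>]] nonneg[of x "x \<circ> \<pi>"] by simp
  have "\<exists>\<pi>. bij \<pi> \<and> y = x \<circ> \<pi>" if "x \<in> ?P" "y \<in> ?P" "tuple_dist C x y = 0" for x y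
  proof -
    obtain S where "S \<in> doubly_stochastic" "coupling_cost C x y S = 0"
      using tuple_dist_attained[of C x y] \<open>tuple_dist C x y = 0\<close> by auto
    then show ?thesis
      by (rule reordering_if_coupling_cost_zero[OF P[OF that(1)] P[OF that(2)]])
  qed
  then have reordering: "reordering (verts G) = {(x, y) \<in> ?P \<times> ?P. tuple_dist C x y = 0}"
    unfolding reordering_def using perm by blast
  \<comment> \<open>The special case of the identity permutation.\<close>
  have refl: "tuple_dist C x x = 0" if "x \<in> ?P" for x
    using perm[OF that bij_id] by simp
  show ?thesis
    using Metric_space_quotient[OF reordering refl nonneg comm tri]
    by (simp add: Prob_unordered_tuples_def lifted_dist_def[abs_def])
qed

end
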